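(* Let $n$ and $p$ be positive integers and let $A$ be a set consisting of exactly $n$ negative integers and $p$ positive integers (so $|A|=n+p$ and $0\notin A$). Let $\alpha$ be an integer with $0\le\alpha\le n+p$. (i) If $\alpha\le n$ and $\alpha\le p$, then $|\Sigma_{\alpha}(A)|\ge \frac{n(n+1)}{2}+\frac{p(p+1)}{2}+1$. (ii) If $\alpha\le n$ and $\alpha>p$, then $|\Sigma_{\alpha}(A)|\ge \frac{n(n+1)}{2}+\frac{p(p+1)}{2}-\frac{(\alpha-p)(\alpha-p+1)}{2}+1$. (iii) If $\alpha>n$ and $\alpha\le p$, then $|\Sigma_{\alpha}(A)|\ge \frac{n(n+1)}{2}+\frac{p(p+1)}{2}-\frac{(\alpha-n)(\alpha-n+1)}{2}+1$. (iv) If $\alpha>n$ and $\alpha>p$, then $|\Sigma_{\alpha}(A)|\ge \frac{n(n+1)}{2}+\frac{p(p+1)}{2}-\frac{(\alpha-n)(\alpha-n+1)}{2}-\frac{(\alpha-p)(\alpha-p+1)}{2}+1$. These lower bounds are optimal, i.e. for all positive integers $n,p$ and every integer $\alpha$ with $0\le\alpha\le n+p$ there is a set $A$ of $n$ negative and $p$ positive integers for which equality holds in the bound of the applicable case.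
   Context: For a set $A$ of $k$ integers and an integer $0\le\alpha\le k$, $\Sigma_{\alpha}(A)=\left\{\sum_{a\in A'}a : A'\subset A,\ |A'|\ge\alpha\right\}$ is the set of sums of all elements of those subsets of $A$ having at least $\alpha$ elements; the sum over the empty subset is $0$. *)

theory Defs
  imports Complex_Main
begin

text \<open>For finite \<open>A\<close>; every \<open>A'\<close> below is then finite, so \<open>card\<close> and \<open>\<Sum>\<close> carry no junk values.\<close>

definition subset_sums :: "nat \<Rightarrow> int set \<Rightarrow> int set" where
  "subset_sums \<alpha> A = {\<Sum>A' | A'. A' \<subseteq> A \<and> \<alpha> \<le> card A'}"

definition neg_pos_set :: "nat \<Rightarrow> nat \<Rightarrow> int set \<Rightarrow> bool" where
  "neg_pos_set n p A \<longleftrightarrow>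
     finite A \<and> 0 \<notin> A \<and> card {a \<in> A. a < 0} = n \<and> card {a \<in> A. a > 0} = p"

end

theory Submission
  imports Defs
begin

text \<open>
  Passing to complements turns sums over at least \<open>\<alpha>\<close> elements of \<open>A\<close> into \<open>\<Sum>A\<close> minus sums over at
  most \<open>m = |A| - \<alpha>\<close> elements. In the latter form the empty set is admissible, so the problem splits
  at \<open>0\<close>: subsets of the positive part give sums \<open>\<ge> 0\<close>, subsets of the negative part give sums
  \<open>\<le> 0\<close>, and only the value \<open>0\<close> is shared.

  It remains to count the sums of at most \<open>m\<close> elements of a set \<open>P\<close> of \<open>p\<close> positive integers. If \<open>D\<close>
  attains the largest sum of at most \<open>k\<close> elements, adjoining each of the at least \<open>p - k\<close> elements of
  \<open>P - D\<close> to \<open>D\<close> yields that many new and pairwise distinct sums of at most \<open>k + 1\<close> elements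
  (\<open>card_small_sums_pos\<close>). Summing over \<open>k < m\<close> gives \<open>1 + p + (p - 1) + \<dots>\<close> with \<open>m\<close> terms after the
  \<open>1\<close>, that is, \<open>1\<close> plus a difference of two triangular numbers; the four cases of the theorem only
  record which of the truncated subtractions vanish (\<open>real_top_sum\<close>).

  For \<open>A = {-n, \<dots>, -1, 1, \<dots>, p}\<close> the very same quantity \<open>p + (p - 1) + \<dots>\<close> is the largest sum of at
  most \<open>m\<close> elements, and symmetrically on the negative side. All sums then lie in an interval
  with exactly as many integers as the lower bound requires, so equality holds.
\<close>

section \<open>Truncated sums of descending integers\<close>

text \<open>The largest sum of at most \<open>k\<close> elements of \<open>{1..p}\<close>. Subtraction is truncated on purpose:
  for \<open>k > p\<close> the surplus terms vanish, so no case distinction is needed until the closed form.\<close>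

definition top_sum :: "nat \<Rightarrow> nat \<Rightarrow> nat" where
  "top_sum p k = (\<Sum>j<k. p - j)"

lemma top_sum_Suc_Suc: "top_sum (Suc p) (Suc k) = Suc p + top_sum p k"
  unfolding top_sum_def by (subst sum.lessThan_Suc_shift) simp

lemma top_sum_closed_form: "2 * top_sum p k + (p - k) * (p - k + 1) = p * (p + 1)"
proof (induction k)
  case 0
  then show ?case by (simp add: top_sum_def)
next
  case (Suc k)
  show ?case
  proof (cases "k < p")
    case True
    then obtain d where "p = Suc (k + d)" using less_iff_Suc_add by blast
    then show ?thesis using Suc by (simp add: top_sum_def algebra_simps)
  next
    case False
    then show ?thesis using Suc by (simp add: top_sum_def)
  qed
qed

text \<open>The shape in which the closed form enters the theorem, where \<open>k\<close> is the number \<open>n + p - \<alpha>\<close> of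
  elements that may be left out: \<open>p - k\<close> is \<open>\<alpha> - n\<close> or is truncated to \<open>0\<close>.\<close>

lemma real_top_sum:
  assumes "\<alpha> \<le> n + p"
  shows "real (top_sum p (n + p - \<alpha>)) =
    (if \<alpha> \<le> n then real p * (real p + 1) / 2
     else real p * (real p + 1) / 2 - (real \<alpha> - real n) * (real \<alpha> - real n + 1) / 2)"
proof -
  have "p - (n + p - \<alpha>) = \<alpha> - n" using assms by linarith
  then have "2 * top_sum p (n + p - \<alpha>) + (\<alpha> - n) * (\<alpha> - n + 1) = p * (p + 1)"
    using top_sum_closed_form[of p "n + p - \<alpha>"] by simp
  then have "2 * real (top_sum p (n + p - \<alpha>)) + real (\<alpha> - n) * (real (\<alpha> - n) + 1)
      = real p * (real p + 1)"
    by (metis (mono_tags, opaque_lifting) of_nat_add of_nat_mult of_nat_1 of_nat_numeral)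
  then show ?thesis by (auto simp: of_nat_diff field_simps)
qed

section \<open>Sums of few elements\<close>

definition small_sums :: "nat \<Rightarrow> int set \<Rightarrow> int set" where
  "small_sums k A = {\<Sum>D | D. D \<subseteq> A \<and> card D \<le> k}"

lemma finite_small_sums: "finite A \<Longrightarrow> finite (small_sums k A)"
proof -
  assume "finite A"
  moreover have "small_sums k A \<subseteq> Sum ` Pow A" by (auto simp: small_sums_def)
  ultimately show ?thesis using finite_subset by blast
qed

lemma small_sums_mono: "A \<subseteq> B \<Longrightarrow> k \<le> l \<Longrightarrow> small_sums k A \<subseteq> small_sums l B"
  unfolding small_sums_def by fastforce

lemma zero_in_small_sums: "0 \<in> small_sums k A"
  unfolding small_sums_def by (auto intro!: exI[of _ "{}"])

lemma small_sums_uminus: "small_sums k (uminus ` A) = uminus ` small_sums k A"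
proof -
  have "uminus ` small_sums k A \<subseteq> small_sums k (uminus ` A)" for A
  proof
    fix x assume "x \<in> uminus ` small_sums k A"
    then obtain D where "D \<subseteq> A" "card D \<le> k" "x = - \<Sum>D" by (auto simp: small_sums_def)
    then have "x = \<Sum>(uminus ` D)" "uminus ` D \<subseteq> uminus ` A" "card (uminus ` D) \<le> k"
      by (auto simp: card_image sum.reindex sum_negf)
    then show "x \<in> small_sums k (uminus ` A)" unfolding small_sums_def by blast
  qed
  from this[of A] this[of "uminus ` A"] show ?thesis
    by (force simp: image_image)
qed

lemma subset_sums_eq_complement:
  assumes "finite A" and "\<alpha> \<le> card A"
  shows "subset_sums \<alpha> A = (\<lambda>s. \<Sum>A - s) ` small_sums (card A - \<alpha>) A"
proof (intro equalityI subsetI)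
  fix x assume "x \<in> subset_sums \<alpha> A"
  then obtain D where D: "D \<subseteq> A" "\<alpha> \<le> card D" "x = \<Sum>D" by (auto simp: subset_sums_def)
  then have "\<Sum>(A - D) \<in> small_sums (card A - \<alpha>) A" "x = \<Sum>A - \<Sum>(A - D)"
    using assms
    by (auto simp: small_sums_def card_Diff_subset finite_subset sum_diff intro!: exI[of _ "A - D"])
  then show "x \<in> (\<lambda>s. \<Sum>A - s) ` small_sums (card A - \<alpha>) A" by blast
next
  fix x assume "x \<in> (\<lambda>s. \<Sum>A - s) ` small_sums (card A - \<alpha>) A"
  then obtain D where D: "D \<subseteq> A" "card D \<le> card A - \<alpha>" "x = \<Sum>A - \<Sum>D"
    by (auto simp: small_sums_def)
  then have "x = \<Sum>(A - D)" "\<alpha> \<le> card (A - D)"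
    using assms by (auto simp: card_Diff_subset finite_subset sum_diff)
  then show "x \<in> subset_sums \<alpha> A" by (auto simp: subset_sums_def)
qed

lemma card_subset_sums_eq:
  assumes "finite A" and "\<alpha> \<le> card A"
  shows "card (subset_sums \<alpha> A) = card (small_sums (card A - \<alpha>) A)"
  unfolding subset_sums_eq_complement[OF assms] by (rule card_image) (simp add: inj_on_def)

section \<open>Lower bound\<close>

text \<open>Induction on \<open>k\<close>. Choosing \<open>D\<close> by the maximality of its sum, rather than as the \<open>k\<close> largest
  elements, makes it immediate that every one-element extension of \<open>D\<close> has a new sum.\<close>

lemma card_small_sums_pos:
  assumes "finite P" and pos: "\<And>x. x \<in> P \<Longrightarrow> x > 0"
  shows "card (small_sums k P) \<ge> top_sum (card P) k + 1"
proof (induction k)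
  case 0
  have "card (small_sums 0 P) > 0"
    using zero_in_small_sums finite_small_sums[OF assms(1)] card_gt_0_iff by blast
  then show ?case by (simp add: top_sum_def)
next
  case (Suc k)
  let ?M = "Max (small_sums k P)"
  have fin: "finite (small_sums l P)" for l using assms(1) by (rule finite_small_sums)
  have "?M \<in> small_sums k P" using fin zero_in_small_sums by (metis Max_in empty_iff)
  then obtain D where D: "D \<subseteq> P" "card D \<le> k" "?M = \<Sum>D" by (auto simp: small_sums_def)
  have finD: "finite D" using D assms(1) finite_subset by blast
  let ?N = "(\<lambda>y. ?M + y) ` (P - D)"
  have "?N \<subseteq> small_sums (Suc k) P"
  proof
    fix z assume "z \<in> ?N"
    then obtain y where "y \<in> P - D" "z = ?M + y" by blast
    then have "z = \<Sum>(insert y D)" "insert y D \<subseteq> P" "card (insert y D) \<le> Suc k"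
      using D finD by auto
    then show "z \<in> small_sums (Suc k) P" unfolding small_sums_def by blast
  qed
  moreover have "small_sums k P \<subseteq> small_sums (Suc k) P" by (rule small_sums_mono) auto
  ultimately have "card (small_sums k P \<union> ?N) \<le> card (small_sums (Suc k) P)"
    by (intro card_mono fin) auto
  moreover have "small_sums k P \<inter> ?N = {}"
    using Max_ge[OF fin[of k]] pos by fastforce
  then have "card (small_sums k P \<union> ?N) = card (small_sums k P) + card ?N"
    using fin assms(1) by (simp add: card_Un_disjoint)
  moreover have "card ?N = card P - card D"
    using D finD by (subst card_image) (auto simp: card_Diff_subset)
  ultimately show ?case using Suc D(2) by (simp add: top_sum_def)
qed

lemma small_sums_nonneg:
  assumes "\<And>x. x \<in> P \<Longrightarrow> x > 0" and "s \<in> small_sums k P"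
  shows "s \<ge> 0"
  using assms by (fastforce simp: small_sums_def intro!: sum_nonneg)

lemma card_small_sums_ge:
  assumes "neg_pos_set n p A"
  shows "card (small_sums k A) \<ge> top_sum n k + top_sum p k + 1"
proof -
  define N where "N = uminus ` {a \<in> A. a < 0}"
  define P where "P = {a \<in> A. a > 0}"
  have A: "finite A" "card P = p" "card N = n" "uminus ` N \<subseteq> A" "P \<subseteq> A"
    using assms by (auto simp: neg_pos_set_def N_def P_def card_image)
  have posP: "\<And>x. x \<in> P \<Longrightarrow> x > 0" and posN: "\<And>x. x \<in> N \<Longrightarrow> x > 0"
    by (auto simp: P_def N_def)
  have fin: "finite P" "finite N" using A by (auto simp: P_def N_def)
  let ?SP = "small_sums k P" and ?SN = "uminus ` small_sums k N"
  have finS: "finite ?SP" "finite ?SN" using fin finite_small_sums by auto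
  have "?SP \<inter> ?SN \<subseteq> {0}"
  proof
    fix x assume x: "x \<in> ?SP \<inter> ?SN"
    then have "x \<ge> 0" using small_sums_nonneg[OF posP] by blast
    moreover from x have "- x \<ge> 0" using small_sums_nonneg[OF posN] by fastforce
    ultimately show "x \<in> {0}" by simp
  qed
  then have "card (?SP \<inter> ?SN) \<le> 1" using card_mono[of "{0::int}"] by fastforce
  moreover have "card ?SP + card ?SN = card (?SP \<union> ?SN) + card (?SP \<inter> ?SN)"
    using finS by (rule card_Un_Int)
  moreover have "card (?SP \<union> ?SN) \<le> card (small_sums k A)"
    using A small_sums_mono[of _ A k k] finite_small_sums
    by (intro card_mono) (auto simp flip: small_sums_uminus)
  moreover have "card ?SP \<ge> top_sum p k + 1"
    using card_small_sums_pos[OF fin(1) posP] A by simp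
  moreover have "card ?SN \<ge> top_sum n k + 1"
    using card_small_sums_pos[OF fin(2) posN] A by (simp add: card_image)
  ultimately show ?thesis by linarith
qed

section \<open>The largest sums of an interval\<close>

text \<open>Once the largest element, itself at most \<open>p\<close>, is removed from \<open>D\<close>, the remaining integers are
  at most \<open>p - 1\<close>; hence the induction on \<open>k\<close> with \<open>p\<close> varying. Elements of \<open>D\<close> may be \<open>0\<close> or
  negative, so that the interval and its mirror image are both covered.\<close>

lemma sum_le_top_sum:
  assumes "finite D" and "D \<subseteq> {..int p}" and "card D \<le> k"
  shows "\<Sum>D \<le> int (top_sum p k)"
  using assms
proof (induction k arbitrary: p D)
  case 0
  then show ?case by simp
next
  case (Suc k)
  consider "D = {}" | "p = 0" | q where "D \<noteq> {}" "p = Suc q" by (cases p) auto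
  then show ?case
  proof cases
    case 1
    then show ?thesis by simp
  next
    case 2
    then have "\<Sum>D \<le> 0" using Suc.prems by (intro sum_nonpos) auto
    then show ?thesis by linarith
  next
    case 3
    let ?x = "Max D"
    have x: "?x \<in> D" "?x \<le> int (Suc q)" using 3 Suc.prems Max_in by auto
    have "D - {?x} \<subseteq> {..int q}"
    proof
      fix y assume y: "y \<in> D - {?x}"
      then have "y < ?x" using Suc.prems(1) by (simp add: order_less_le)
      then show "y \<in> {..int q}" using x by simp
    qed
    then have "\<Sum>(D - {?x}) \<le> int (top_sum q k)"
      using Suc.prems x by (intro Suc.IH) auto
    moreover have "\<Sum>D = ?x + \<Sum>(D - {?x})" using Suc.prems(1) x(1) by (simp add: sum.remove)
    ultimately show ?thesis using x 3 by (simp add: top_sum_Suc_Suc)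
  qed
qed

lemma card_small_sums_interval_le:
  "card (small_sums k ({- int n..int p} - {0})) \<le> top_sum n k + top_sum p k + 1"
proof -
  have "small_sums k ({- int n..int p} - {0}) \<subseteq> {- int (top_sum n k)..int (top_sum p k)}"
  proof
    fix s assume "s \<in> small_sums k ({- int n..int p} - {0})"
    then obtain D where D: "D \<subseteq> {- int n..int p}" "card D \<le> k" "s = \<Sum>D"
      by (auto simp: small_sums_def)
    then have fin: "finite D" using finite_subset by blast
    then have "s \<le> int (top_sum p k)" using D sum_le_top_sum[OF fin, of p k] by force
    moreover have "\<Sum>(uminus ` D) \<le> int (top_sum n k)"
      using D fin by (intro sum_le_top_sum) (auto simp: card_image)
    then have "- s \<le> int (top_sum n k)" using D by (simp add: sum.reindex sum_negf)
    ultimately show "s \<in> {- int (top_sum n k)..int (top_sum p k)}" by simp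
  qed
  then have "card (small_sums k ({- int n..int p} - {0}))
      \<le> card {- int (top_sum n k)..int (top_sum p k)}"
    by (intro card_mono) auto
  then show ?thesis by simp
qed

section \<open>Sets with prescribed numbers of negative and positive elements\<close>

lemma neg_pos_set_card:
  assumes "neg_pos_set n p A"
  shows "card A = n + p"
proof -
  have "x < 0 \<or> x > 0" if "x \<in> A" for x
    using that assms by (cases x "0::int" rule: linorder_cases) (auto simp: neg_pos_set_def)
  then have "A = {a \<in> A. a < 0} \<union> {a \<in> A. a > 0}" by blast
  moreover have "card ({a \<in> A. a < 0} \<union> {a \<in> A. a > 0}) = n + p"
    using assms by (subst card_Un_disjoint) (auto simp: neg_pos_set_def)
  ultimately show ?thesis by metis
qed

lemma neg_pos_set_interval: "neg_pos_set n p ({- int n..int p} - {0})"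
proof -
  have "{a \<in> {- int n..int p} - {0}. a < 0} = {- int n..-1}"
    and "{a \<in> {- int n..int p} - {0}. a > 0} = {1..int p}" by auto
  then show ?thesis by (simp add: neg_pos_set_def)
qed

theorem theorem5:
  fixes n p \<alpha> :: nat
  assumes "n > 0" and "p > 0" and "\<alpha> \<le> n + p"
  shows "(\<forall>A. neg_pos_set n p A \<longrightarrow>
         (\<alpha> \<le> n \<and> \<alpha> \<le> p \<longrightarrow>
            real (card (subset_sums \<alpha> A))
              \<ge> real n * (real n + 1) / 2 + real p * (real p + 1) / 2 + 1) \<and>
         (\<alpha> \<le> n \<and> \<alpha> > p \<longrightarrow>
            real (card (subset_sums \<alpha> A))
              \<ge> real n * (real n + 1) / 2 + real p * (real p + 1) / 2 - (real \<alpha> - real p) * (real \<alpha> - real p + 1) / 2 + 1) \<and>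
         (\<alpha> > n \<and> \<alpha> \<le> p \<longrightarrow>
            real (card (subset_sums \<alpha> A))
              \<ge> real n * (real n + 1) / 2 + real p * (real p + 1) / 2 - (real \<alpha> - real n) * (real \<alpha> - real n + 1) / 2 + 1) \<and>
         (\<alpha> > n \<and> \<alpha> > p \<longrightarrow>
            real (card (subset_sums \<alpha> A))
              \<ge> real n * (real n + 1) / 2 + real p * (real p + 1) / 2 - (real \<alpha> - real n) * (real \<alpha> - real n + 1) / 2 - (real \<alpha> - real p) * (real \<alpha> - real p + 1) / 2 + 1)) \<and>
    (\<exists>A. neg_pos_set n p A \<and>
         (\<alpha> \<le> n \<and> \<alpha> \<le> p \<longrightarrow>
            real (card (subset_sums \<alpha> A))
              = real n * (real n + 1) / 2 + real p * (real p + 1) / 2 + 1) \<and>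
         (\<alpha> \<le> n \<and> \<alpha> > p \<longrightarrow>
            real (card (subset_sums \<alpha> A))
              = real n * (real n + 1) / 2 + real p * (real p + 1) / 2 - (real \<alpha> - real p) * (real \<alpha> - real p + 1) / 2 + 1) \<and>
         (\<alpha> > n \<and> \<alpha> \<le> p \<longrightarrow>
            real (card (subset_sums \<alpha> A))
              = real n * (real n + 1) / 2 + real p * (real p + 1) / 2 - (real \<alpha> - real n) * (real \<alpha> - real n + 1) / 2 + 1) \<and>
         (\<alpha> > n \<and> \<alpha> > p \<longrightarrow>
            real (card (subset_sums \<alpha> A))
              = real n * (real n + 1) / 2 + real p * (real p + 1) / 2 - (real \<alpha> - real n) * (real \<alpha> - real n + 1) / 2 - (real \<alpha> - real p) * (real \<alpha> - real p + 1) / 2 + 1))"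
proof -
  define m where "m = n + p - \<alpha>"
  let ?I = "{- int n..int p} - {0}"
  have card_eq: "card (subset_sums \<alpha> A) = card (small_sums m A)" if "neg_pos_set n p A" for A
    using that assms(3) neg_pos_set_card[OF that] card_subset_sums_eq[of A \<alpha>]
    by (simp add: m_def neg_pos_set_def)
  have lower: "real (card (subset_sums \<alpha> A)) \<ge> real (top_sum n m) + real (top_sum p m) + 1"
    if "neg_pos_set n p A" for A
    using card_small_sums_ge[OF that, of m] card_eq[OF that] by linarith
  have I: "neg_pos_set n p ?I" by (rule neg_pos_set_interval)
  have extremal: "real (card (subset_sums \<alpha> ?I)) = real (top_sum n m) + real (top_sum p m) + 1"
    using lower[OF I] card_small_sums_interval_le[of m n p] card_eq[OF I] by linarith
  have tp: "real (top_sum p m) =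
    (if \<alpha> \<le> n then real p * (real p + 1) / 2
     else real p * (real p + 1) / 2 - (real \<alpha> - real n) * (real \<alpha> - real n + 1) / 2)"
    using real_top_sum[OF assms(3)] by (simp add: m_def)
  have tn: "real (top_sum n m) =
    (if \<alpha> \<le> p then real n * (real n + 1) / 2
     else real n * (real n + 1) / 2 - (real \<alpha> - real p) * (real \<alpha> - real p + 1) / 2)"
    using real_top_sum[of \<alpha> p n] assms(3) by (simp add: m_def add.commute)
  have "\<forall>A. neg_pos_set n p A \<longrightarrow>
      real (card (subset_sums \<alpha> A)) \<ge> real (top_sum n m) + real (top_sum p m) + 1"
    using lower by blast
  moreover have "\<exists>A. neg_pos_set n p A \<and>
      real (card (subset_sums \<alpha> A)) = real (top_sum n m) + real (top_sum p m) + 1"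
    using I extremal by blast
  ultimately show ?thesis
    unfolding tp tn by (cases "\<alpha> \<le> n"; cases "\<alpha> \<le> p"; simp add: algebra_simps)
qed

end
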